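(* Let $n>2$ and let $t$ be a real number with $t\neq 0,1,-1$. For $1\le m<n$ let $(\phi_m,V_m)$ be the following representation of the braid group $\mathbb{B}_n$: $V_m$ is the complex vector space with basis $\{v_x : x\in X_m\}$, where $X_m$ is the set of $n$-tuples in $\{0,1\}^n$ with exactly $m$ coordinates equal to $1$, and $$\phi_m(\tau_k)v_x=q_{x_k,x_{k+1}}\,v_{\sigma_k(x)},\qquad q_{x_k,x_{k+1}}=\begin{cases}1 & \text{if } x_k=x_{k+1},\\ t & \text{if } x_k\neq x_{k+1},\end{cases}$$ for $1\le k\le n-1$, $x\in X_m$, where $\sigma_k(x)$ is obtained from $x$ by exchanging the coordinates $x_k$ and $x_{k+1}$. Then $(\phi_m,V_m)$ is an irreducible representation of $\mathbb{B}_n$ for all $1\le m<n$ such that $2m\neq n$. If $n=2m$, then $(\phi_m,V_m)$ is the (direct) sum of two irreducible representations of $\mathbb{B}_n$.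
   Context: The braid group $\mathbb{B}_n$ on $n$ strings is the group with generators $\tau_1,\dots,\tau_{n-1}$ and relations $\tau_k\tau_j=\tau_j\tau_k$ if $|k-j|>1$, and $\tau_k\tau_{k+1}\tau_k=\tau_{k+1}\tau_k\tau_{k+1}$ for $1\le k\le n-2$. A representation of $\mathbb{B}_n$ is a pair $(\phi,V)$ with $V$ a finite dimensional complex vector space and $\phi:\mathbb{B}_n\to\operatorname{Aut}(V)$ a group homomorphism; the formula for $\phi_m(\tau_k)$ defines a representation of $\mathbb{B}_n$. *)

theory Defs
  imports Complex_Main "HOL-Algebra.Bij" "HOL-Library.Function_Algebras"
begin

section \<open>Groups given by generators and relations\<close>

text \<open>The letter \<open>(a, True)\<close> stands for the generator \<open>a\<close>, the letter \<open>(a, False)\<close> for its formal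
  inverse. A relation \<open>l = r\<close> is the pair \<open>(l, r)\<close>.\<close>

type_synonym 'a word = "('a \<times> bool) list"

definition group_words :: "'a set \<Rightarrow> 'a word set" where
  "group_words S = lists (S \<times> UNIV)"

inductive word_eq :: "'a set \<Rightarrow> ('a word \<times> 'a word) set \<Rightarrow> 'a word \<Rightarrow> 'a word \<Rightarrow> bool"
  for S R where
    refl: "w \<in> group_words S \<Longrightarrow> word_eq S R w w"
  | sym: "word_eq S R u v \<Longrightarrow> word_eq S R v u"
  | trans: "word_eq S R u v \<Longrightarrow> word_eq S R v w \<Longrightarrow> word_eq S R u w"
  | cancel: "a \<in> S \<Longrightarrow> u \<in> group_words S \<Longrightarrow> v \<in> group_words S
      \<Longrightarrow> word_eq S R (u @ [(a, b), (a, \<not> b)] @ v) (u @ v)"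
  | relation: "(l, r) \<in> R \<Longrightarrow> u @ l @ v \<in> group_words S \<Longrightarrow> u @ r @ v \<in> group_words S
      \<Longrightarrow> word_eq S R (u @ l @ v) (u @ r @ v)"

definition word_class :: "'a set \<Rightarrow> ('a word \<times> 'a word) set \<Rightarrow> 'a word \<Rightarrow> 'a word set" where
  "word_class S R w = {u. word_eq S R w u}"

definition presented_group :: "'a set \<Rightarrow> ('a word \<times> 'a word) set \<Rightarrow> 'a word set monoid" where
  "presented_group S R =
    \<lparr>carrier = word_class S R ` group_words S,
     mult = \<lambda>A B. \<Union>u\<in>A. \<Union>v\<in>B. word_class S R (u @ v),
     one = word_class S R []\<rparr>"

primrec word_value :: "('g, 'b) monoid_scheme \<Rightarrow> ('a \<Rightarrow> 'g) \<Rightarrow> 'a word \<Rightarrow> 'g" where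
  "word_value H g [] = \<one>\<^bsub>H\<^esub>"
| "word_value H g (l # w) =
    (if snd l then g (fst l) else inv\<^bsub>H\<^esub> g (fst l)) \<otimes>\<^bsub>H\<^esub> word_value H g w"

text \<open>The map on a presented group with values \<open>g\<close> on the generators; the chosen representative of
  the class is irrelevant as soon as \<open>g\<close> respects the relations (\<open>presentation_lift_class\<close>).\<close>

definition presentation_lift :: "('g, 'b) monoid_scheme \<Rightarrow> ('a \<Rightarrow> 'g) \<Rightarrow> 'a word set \<Rightarrow> 'g" where
  "presentation_lift H g C = word_value H g (SOME w. w \<in> C)"

lemma word_eq_words: "word_eq S R u v \<Longrightarrow> u \<in> group_words S \<and> v \<in> group_words S"
  by (induction rule: word_eq.induct) (auto simp: group_words_def)

lemma word_eq_append:
  "word_eq S R u v \<Longrightarrow> x \<in> group_words S \<Longrightarrow> y \<in> group_words S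
    \<Longrightarrow> word_eq S R (x @ u @ y) (x @ v @ y)"
proof (induction rule: word_eq.induct)
  case (refl w)
  then show ?case by (intro word_eq.refl) (auto simp: group_words_def)
next
  case (sym u v)
  then show ?case by (blast intro: word_eq.sym)
next
  case (trans u v w)
  then show ?case by (blast intro: word_eq.trans)
next
  case (cancel a u v b)
  then show ?case
    using word_eq.cancel[of a S "x @ u" "v @ y" R b] by (simp add: group_words_def)
next
  case (relation l r u v)
  then show ?case
    using word_eq.relation[of l r R "x @ u" "v @ y" S] by (simp add: group_words_def)
qed

lemma word_eq_append2:
  assumes "word_eq S R u u'" "word_eq S R v v'"
  shows "word_eq S R (u @ v) (u' @ v')"
proof -
  have nil: "[] \<in> group_words S" by (simp add: group_words_def)
  have "word_eq S R (u @ v) (u' @ v)"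
    using word_eq_append[OF assms(1) nil, of v] word_eq_words[OF assms(2)] by simp
  moreover have "word_eq S R (u' @ v) (u' @ v')"
    using word_eq_append[OF assms(2) _ nil, of u'] word_eq_words[OF assms(1)] by simp
  ultimately show ?thesis by (rule word_eq.trans)
qed

lemma word_class_eqI: "word_eq S R u v \<Longrightarrow> word_class S R u = word_class S R v"
  unfolding word_class_def
  by (rule Collect_cong, rule iffI) (erule (1) word_eq.trans[OF word_eq.sym], erule (1) word_eq.trans)

lemma presented_group_mult:
  assumes "u \<in> group_words S" "v \<in> group_words S"
  shows "word_class S R u \<otimes>\<^bsub>presented_group S R\<^esub> word_class S R v = word_class S R (u @ v)"
proof -
  have "word_class S R (u' @ v') = word_class S R (u @ v)"
    if "u' \<in> word_class S R u" "v' \<in> word_class S R v" for u' v'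
    using that unfolding word_class_def[of S R u] word_class_def[of S R v]
    by (intro word_class_eqI[OF word_eq.sym]) (simp add: word_eq_append2)
  moreover have "u \<in> word_class S R u" "v \<in> word_class S R v"
    using assms by (auto simp: word_class_def intro: word_eq.refl)
  ultimately have "(\<Union>u'\<in>word_class S R u. \<Union>v'\<in>word_class S R v. word_class S R (u' @ v')) =
      word_class S R (u @ v)"
    by blast
  then show ?thesis by (simp add: presented_group_def)
qed

lemma word_inverse:
  "w \<in> group_words S \<Longrightarrow> \<exists>w'\<in>group_words S. word_eq S R (w' @ w) []"
proof (induction w)
  case Nil
  then show ?case by (intro bexI[of _ "[]"]) (auto simp: group_words_def intro!: word_eq.refl)
next
  case (Cons l w)
  obtain a b where l: "l = (a, b)" by force
  from Cons have a: "a \<in> S" and w: "w \<in> group_words S" by (auto simp: group_words_def l)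
  from Cons w obtain w' where w': "w' \<in> group_words S" "word_eq S R (w' @ w) []" by blast
  have "word_eq S R ((w' @ [(a, \<not> b)]) @ l # w) (w' @ w)"
    using word_eq.cancel[OF a w'(1) w, of R "\<not> b"] by (simp add: l)
  moreover have "w' @ [(a, \<not> b)] \<in> group_words S" using w'(1) a by (simp add: group_words_def)
  ultimately show ?case using w'(2) by (blast intro: word_eq.trans)
qed

lemma group_presented_group: "group (presented_group S R)"
proof (rule groupI)
  note [simp] = presented_group_mult
  have car: "carrier (presented_group S R) = word_class S R ` group_words S"
    and one: "\<one>\<^bsub>presented_group S R\<^esub> = word_class S R []"
    by (simp_all add: presented_group_def)
  have app: "u @ v \<in> group_words S" if "u \<in> group_words S" "v \<in> group_words S" for u v :: "'a word"
    using that by (simp add: group_words_def)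
  have nil: "[] \<in> group_words S" by (simp add: group_words_def)
  show "\<one>\<^bsub>presented_group S R\<^esub> \<in> carrier (presented_group S R)"
    using nil by (simp add: car one)
  fix x assume "x \<in> carrier (presented_group S R)"
  then obtain u where u: "u \<in> group_words S" "x = word_class S R u" by (auto simp: car)
  show "\<one>\<^bsub>presented_group S R\<^esub> \<otimes>\<^bsub>presented_group S R\<^esub> x = x"
    using u nil by (simp add: one)
  obtain u' where u': "u' \<in> group_words S" "word_eq S R (u' @ u) []" using word_inverse[OF u(1)] by blast
  show "\<exists>y\<in>carrier (presented_group S R).
      y \<otimes>\<^bsub>presented_group S R\<^esub> x = \<one>\<^bsub>presented_group S R\<^esub>"
    using u u'(1) word_class_eqI[OF u'(2)] by (auto simp: car one intro!: bexI[of _ u'])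
  fix y assume "y \<in> carrier (presented_group S R)"
  then obtain v where v: "v \<in> group_words S" "y = word_class S R v" by (auto simp: car)
  show "x \<otimes>\<^bsub>presented_group S R\<^esub> y \<in> carrier (presented_group S R)"
    using u v app by (simp add: car)
  fix z assume "z \<in> carrier (presented_group S R)"
  then obtain w where w: "w \<in> group_words S" "z = word_class S R w" by (auto simp: car)
  show "x \<otimes>\<^bsub>presented_group S R\<^esub> y \<otimes>\<^bsub>presented_group S R\<^esub> z =
      x \<otimes>\<^bsub>presented_group S R\<^esub> (y \<otimes>\<^bsub>presented_group S R\<^esub> z)"
    using u v w app by simp
qed

context
  fixes H :: "('g, 'b) monoid_scheme" (structure) and g :: "'a \<Rightarrow> 'g" and S :: "'a set"
  assumes H: "group H" and g: "g ` S \<subseteq> carrier H"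
begin

interpretation group H by (rule H)

lemma word_value_closed: "w \<in> group_words S \<Longrightarrow> word_value H g w \<in> carrier H"
proof (induction w)
  case (Cons l w)
  then have "w \<in> group_words S" "g (fst l) \<in> carrier H" using g by (auto simp: group_words_def)
  with Cons.IH show ?case by simp
qed simp

lemma word_value_append:
  "u \<in> group_words S \<Longrightarrow> v \<in> group_words S
    \<Longrightarrow> word_value H g (u @ v) = word_value H g u \<otimes> word_value H g v"
proof (induction u)
  case Nil
  then show ?case using word_value_closed by simp
next
  case (Cons l u)
  then have "u \<in> group_words S" "g (fst l) \<in> carrier H" using g by (auto simp: group_words_def)
  with Cons show ?case using word_value_closed by (simp add: m_assoc)
qed

context
  fixes R :: "('a word \<times> 'a word) set"
  assumes R: "\<And>l r. (l, r) \<in> R \<Longrightarrow> word_value H g l = word_value H g r"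
begin

lemma word_value_eq: "word_eq S R u v \<Longrightarrow> word_value H g u = word_value H g v"
proof (induction rule: word_eq.induct)
  case (cancel a u v b)
  then have "g a \<in> carrier H" using g by blast
  with cancel have "word_value H g ([(a, b), (a, \<not> b)] @ v) = word_value H g v"
    using word_value_closed by (cases b) (simp_all add: m_assoc[symmetric])
  moreover have "[(a, b), (a, \<not> b)] @ v \<in> group_words S"
    using cancel by (simp add: group_words_def)
  ultimately show ?case
    using cancel word_value_append by metis
next
  case (relation l r u v)
  then have "u \<in> group_words S" "v \<in> group_words S" "l \<in> group_words S" "r \<in> group_words S"
    "l @ v \<in> group_words S" "r @ v \<in> group_words S"
    by (simp_all add: group_words_def)
  with R[OF relation(1)] show ?case by (simp add: word_value_append)
qed simp_all

lemma presentation_lift_class: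
  assumes "w \<in> group_words S"
  shows "presentation_lift H g (word_class S R w) = word_value H g w"
proof -
  have "w \<in> word_class S R w" using assms by (simp add: word_class_def word_eq.refl)
  then have "(SOME u. u \<in> word_class S R w) \<in> word_class S R w" by (rule someI)
  then show ?thesis
    unfolding presentation_lift_def by (metis mem_Collect_eq word_class_def word_value_eq)
qed

lemma presentation_lift_hom: "presentation_lift H g \<in> hom (presented_group S R) H"
proof (rule homI)
  have car: "carrier (presented_group S R) = word_class S R ` group_words S"
    by (simp add: presented_group_def)
  fix x assume "x \<in> carrier (presented_group S R)"
  then obtain u where u: "u \<in> group_words S" "x = word_class S R u" by (auto simp: car)
  show "presentation_lift H g x \<in> carrier H"
    using u by (simp add: presentation_lift_class word_value_closed)
  fix y assume "y \<in> carrier (presented_group S R)"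
  then obtain v where v: "v \<in> group_words S" "y = word_class S R v" by (auto simp: car)
  have "u @ v \<in> group_words S" using u v by (simp add: group_words_def)
  with u v show "presentation_lift H g (x \<otimes>\<^bsub>presented_group S R\<^esub> y) =
      presentation_lift H g x \<otimes> presentation_lift H g y"
    by (simp add: presentation_lift_class presented_group_mult word_value_append)
qed

end

end


section \<open>The braid group\<close>

definition braid_generators :: "nat \<Rightarrow> nat set" where
  "braid_generators n = {1..n - 1}"

definition braid_relations :: "nat \<Rightarrow> (nat word \<times> nat word) set" where
  "braid_relations n =
    {([(k, True), (j, True)], [(j, True), (k, True)]) | k j.
      k \<in> {1..n - 1} \<and> j \<in> {1..n - 1} \<and> \<bar>int k - int j\<bar> > 1} \<union>
    {([(k, True), (k + 1, True), (k, True)], [(k + 1, True), (k, True), (k + 1, True)]) | k.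
      k \<in> {1..n - 2}}"

definition braid_group :: "nat \<Rightarrow> nat word set monoid" where
  "braid_group n = presented_group (braid_generators n) (braid_relations n)"

definition braid_generator :: "nat \<Rightarrow> nat \<Rightarrow> nat word set" where
  "braid_generator n k = word_class (braid_generators n) (braid_relations n) [(k, True)]"


section \<open>Finite dimensional complex representations\<close>

text \<open>A vector space is a subspace \<open>V\<close> of a complex vector space with scalar multiplication
  \<open>s\<close>.\<close>

definition linear_aut_group :: "(complex \<Rightarrow> 'v \<Rightarrow> 'v) \<Rightarrow> 'v::ab_group_add set \<Rightarrow> ('v \<Rightarrow> 'v) monoid" where
  "linear_aut_group s V = BijGroup V
    \<lparr>carrier := {f \<in> Bij V. (\<forall>u\<in>V. \<forall>v\<in>V. f (u + v) = f u + f v) \<and>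
                           (\<forall>c. \<forall>v\<in>V. f (s c v) = s c (f v))}\<rparr>"

definition representation ::
    "('g, 'b) monoid_scheme \<Rightarrow> (complex \<Rightarrow> 'v \<Rightarrow> 'v) \<Rightarrow> 'v::ab_group_add set \<Rightarrow> ('g \<Rightarrow> 'v \<Rightarrow> 'v) \<Rightarrow> bool"
  where "representation G s V \<phi> \<longleftrightarrow>
    group G \<and> vector_space s \<and> module.subspace s V \<and>
    (\<exists>B. finite B \<and> module.span s B = V) \<and> \<phi> \<in> hom G (linear_aut_group s V)"

definition invariant_subspace ::
    "('g, 'b) monoid_scheme \<Rightarrow> (complex \<Rightarrow> 'v \<Rightarrow> 'v) \<Rightarrow> 'v::ab_group_add set \<Rightarrow> ('g \<Rightarrow> 'v \<Rightarrow> 'v) \<Rightarrow> 'v set \<Rightarrow> bool"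
  where "invariant_subspace G s V \<phi> W \<longleftrightarrow>
    module.subspace s W \<and> W \<subseteq> V \<and> (\<forall>x\<in>carrier G. \<phi> x ` W \<subseteq> W)"

definition irreducible_representation ::
    "('g, 'b) monoid_scheme \<Rightarrow> (complex \<Rightarrow> 'v \<Rightarrow> 'v) \<Rightarrow> 'v::ab_group_add set \<Rightarrow> ('g \<Rightarrow> 'v \<Rightarrow> 'v) \<Rightarrow> bool"
  where "irreducible_representation G s V \<phi> \<longleftrightarrow>
    representation G s V \<phi> \<and> V \<noteq> {0} \<and>
    (\<forall>W. invariant_subspace G s V \<phi> W \<longrightarrow> W = {0} \<or> W = V)"

definition subrepresentation :: "('g \<Rightarrow> 'v \<Rightarrow> 'v) \<Rightarrow> 'v set \<Rightarrow> 'g \<Rightarrow> 'v \<Rightarrow> 'v" where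
  "subrepresentation \<phi> W = (\<lambda>x. restrict (\<phi> x) W)"

definition sum_of_two_irreducibles ::
    "('g, 'b) monoid_scheme \<Rightarrow> (complex \<Rightarrow> 'v \<Rightarrow> 'v) \<Rightarrow> 'v::ab_group_add set \<Rightarrow> ('g \<Rightarrow> 'v \<Rightarrow> 'v) \<Rightarrow> bool"
  where "sum_of_two_irreducibles G s V \<phi> \<longleftrightarrow>
    representation G s V \<phi> \<and>
    (\<exists>W1 W2. invariant_subspace G s V \<phi> W1 \<and> invariant_subspace G s V \<phi> W2 \<and>
      V = {u + v | u v. u \<in> W1 \<and> v \<in> W2} \<and> W1 \<inter> W2 = {0} \<and>
      irreducible_representation G s W1 (subrepresentation \<phi> W1) \<and>
      irreducible_representation G s W2 (subrepresentation \<phi> W2))"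

lemma group_linear_aut_group:
  assumes "vector_space s" "module.subspace s V"
  shows "group (linear_aut_group s V)"
proof -
  interpret vector_space s by fact
  let ?L = "{f \<in> Bij V. (\<forall>u\<in>V. \<forall>v\<in>V. f (u + v) = f u + f v) \<and> (\<forall>c. \<forall>v\<in>V. f (s c v) = s c (f v))}"
  have add: "u + v \<in> V" if "u \<in> V" "v \<in> V" for u v using assms(2) that by (rule subspace_add)
  have scale: "s c v \<in> V" if "v \<in> V" for c v using assms(2) that by (rule subspace_scale)
  have "subgroup ?L (BijGroup V)"
  proof (rule subgroup.intro)
    show "?L \<subseteq> carrier (BijGroup V)" by (auto simp: BijGroup_def)
    show "\<one>\<^bsub>BijGroup V\<^esub> \<in> ?L" using add scale id_Bij[of V] by (simp add: BijGroup_def)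
    show "f \<otimes>\<^bsub>BijGroup V\<^esub> h \<in> ?L" if "f \<in> ?L" "h \<in> ?L" for f h
    proof -
      have "h v \<in> V" if "v \<in> V" for v
        using \<open>h \<in> ?L\<close> that by (auto dest: Bij_imp_funcset)
      then show ?thesis
        using that add scale compose_Bij[of f V h] by (simp add: BijGroup_def compose_eq)
    qed
    show "inv\<^bsub>BijGroup V\<^esub> f \<in> ?L" if "f \<in> ?L" for f
    proof -
      from that have f: "f \<in> Bij V" by simp
      have "inv_into V f (u + v) = inv_into V f u + inv_into V f v" if "u \<in> V" "v \<in> V" for u v
        using Bij_inv_into_lemma[of V f "(+)" u v] \<open>f \<in> ?L\<close> add that by auto
      moreover have "inv_into V f (s c v) = s c (inv_into V f v)" if "v \<in> V" for c v
        using Bij_inv_into_lemma[of V f "\<lambda>_. s c" v v] \<open>f \<in> ?L\<close> scale that by auto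
      ultimately show ?thesis
        using f add scale restrict_inv_into_Bij[OF f] by (simp add: inv_BijGroup)
    qed
  qed
  then show ?thesis
    unfolding linear_aut_group_def using group_BijGroup by (rule subgroup.subgroup_is_group)
qed


section \<open>The representations \<open>(\<phi>\<^sub>m, V\<^sub>m)\<close>\<close>

text \<open>An \<open>n\<close>-tuple is an extensional function on \<open>{1..n}\<close>. The space with basis
  \<open>{v\<^sub>x | x \<in> X\<^sub>m}\<close> consists of the complex functions on tuples that vanish off \<open>X\<^sub>m\<close>.\<close>

definition tuples :: "nat \<Rightarrow> nat \<Rightarrow> (nat \<Rightarrow> nat) set" where
  "tuples n m = {x \<in> {1..n} \<rightarrow>\<^sub>E {0, 1}. card {i \<in> {1..n}. x i = 1} = m}"

definition exchange :: "nat \<Rightarrow> (nat \<Rightarrow> nat) \<Rightarrow> nat \<Rightarrow> nat" where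
  "exchange k x = x(k := x (k + 1), k + 1 := x k)"

definition fun_scale :: "complex \<Rightarrow> ('x \<Rightarrow> complex) \<Rightarrow> 'x \<Rightarrow> complex" where
  "fun_scale c f = (\<lambda>y. c * f y)"

definition basis_vector :: "'x \<Rightarrow> 'x \<Rightarrow> complex" where
  "basis_vector x = (\<lambda>y. if y = x then 1 else 0)"

definition braid_space :: "nat \<Rightarrow> nat \<Rightarrow> ((nat \<Rightarrow> nat) \<Rightarrow> complex) set" where
  "braid_space n m = {f. \<forall>y. y \<notin> tuples n m \<longrightarrow> f y = 0}"

definition braid_coeff :: "real \<Rightarrow> nat \<Rightarrow> nat \<Rightarrow> complex" where
  "braid_coeff t a b = (if a = b then 1 else complex_of_real t)"

definition braid_operator ::
    "nat \<Rightarrow> nat \<Rightarrow> real \<Rightarrow> nat \<Rightarrow> ((nat \<Rightarrow> nat) \<Rightarrow> complex) \<Rightarrow> (nat \<Rightarrow> nat) \<Rightarrow> complex" where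
  "braid_operator n m t k = (\<lambda>f\<in>braid_space n m.
    \<Sum>x\<in>tuples n m. fun_scale (f x)
      (fun_scale (braid_coeff t (x k) (x (k + 1))) (basis_vector (exchange k x))))"

definition braid_rep ::
    "nat \<Rightarrow> nat \<Rightarrow> real \<Rightarrow> nat word set \<Rightarrow> ((nat \<Rightarrow> nat) \<Rightarrow> complex) \<Rightarrow> (nat \<Rightarrow> nat) \<Rightarrow> complex" where
  "braid_rep n m t =
    presentation_lift (linear_aut_group fun_scale (braid_space n m)) (braid_operator n m t)"

lemma vector_space_fun_scale: "vector_space fun_scale"
  by unfold_locales (rule ext; simp add: fun_scale_def distrib_left distrib_right)+

interpretation fun_space: vector_space fun_scale
  by (rule vector_space_fun_scale)

lemma subspace_braid_space: "fun_space.subspace (braid_space n m)"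
  by (auto simp: fun_space.subspace_def braid_space_def fun_scale_def)

lemma finite_tuples: "finite (tuples n m)"
  by (rule finite_subset[of _ "{1..n} \<rightarrow>\<^sub>E {0, 1}"]) (auto simp: tuples_def intro: finite_PiE)

lemma sum_fun_apply: "(\<Sum>x\<in>A. F x) y = (\<Sum>x\<in>A. F x y :: complex)"
  by (induction A rule: infinite_finite_induct) auto

lemma basis_expansion:
  assumes "f \<in> braid_space n m"
  shows "f = (\<Sum>x\<in>tuples n m. fun_scale (f x) (basis_vector x))"
proof
  fix y
  show "f y = (\<Sum>x\<in>tuples n m. fun_scale (f x) (basis_vector x)) y"
    using assms finite_tuples[of n m]
    by (cases "y \<in> tuples n m")
       (auto simp: sum_fun_apply fun_scale_def basis_vector_def braid_space_def if_distrib sum.delta cong: if_cong)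
qed

lemma basis_vector_in_space: "x \<in> tuples n m \<Longrightarrow> basis_vector x \<in> braid_space n m"
  by (auto simp: braid_space_def basis_vector_def)

lemma span_basis_vectors: "fun_space.span (basis_vector ` tuples n m) = braid_space n m"
proof
  show "fun_space.span (basis_vector ` tuples n m) \<subseteq> braid_space n m"
    by (rule fun_space.span_minimal) (auto simp: subspace_braid_space basis_vector_in_space)
  show "braid_space n m \<subseteq> fun_space.span (basis_vector ` tuples n m)"
  proof
    fix f assume "f \<in> braid_space n m"
    then have "f = (\<Sum>x\<in>tuples n m. fun_scale (f x) (basis_vector x))" by (rule basis_expansion)
    also have "\<dots> \<in> fun_space.span (basis_vector ` tuples n m)"
      by (intro fun_space.span_sum fun_space.span_scale fun_space.span_base imageI)
    finally show "f \<in> fun_space.span (basis_vector ` tuples n m)" .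
  qed
qed

lemma exchange_exchange [simp]: "exchange k (exchange k x) = x"
  by (auto simp: exchange_def)

lemma exchange_tuples:
  assumes "k \<in> braid_generators n" "x \<in> tuples n m"
  shows "exchange k x \<in> tuples n m"
proof -
  have k: "k \<in> {1..n}" "k + 1 \<in> {1..n}" using assms(1) by (auto simp: braid_generators_def)
  let ?t = "id(k := k + 1, k + 1 := k)"
  have ex: "exchange k x = x \<circ> ?t" by (auto simp: exchange_def)
  have t: "?t i \<in> {1..n} \<longleftrightarrow> i \<in> {1..n}" for i using k by auto
  have "bij_betw ?t {i \<in> {1..n}. (x \<circ> ?t) i = 1} {i \<in> {1..n}. x i = 1}"
  proof (rule bij_betw_byWitness[where f' = ?t])
    show "?t ` {i \<in> {1..n}. (x \<circ> ?t) i = 1} \<subseteq> {i \<in> {1..n}. x i = 1}"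
      using t by fastforce
    show "?t ` {i \<in> {1..n}. x i = 1} \<subseteq> {i \<in> {1..n}. (x \<circ> ?t) i = 1}"
      using t by fastforce
  qed auto
  then have "card {i \<in> {1..n}. (x \<circ> ?t) i = 1} = card {i \<in> {1..n}. x i = 1}"
    by (rule bij_betw_same_card)
  moreover have "exchange k x \<in> {1..n} \<rightarrow>\<^sub>E {0, 1}"
    using assms(2) k by (auto simp: tuples_def exchange_def PiE_iff extensional_def)
  ultimately show ?thesis using assms(2) by (simp add: tuples_def ex)
qed

lemma exchange_tuples_iff:
  "k \<in> braid_generators n \<Longrightarrow> exchange k x \<in> tuples n m \<longleftrightarrow> x \<in> tuples n m"
  using exchange_tuples[of k n x m] exchange_tuples[of k n "exchange k x" m] by auto

lemma braid_operator_apply: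
  assumes k: "k \<in> braid_generators n" and f: "f \<in> braid_space n m"
  shows "braid_operator n m t k f y = braid_coeff t (y k) (y (k + 1)) * f (exchange k y)"
proof -
  have "braid_operator n m t k f y =
      (\<Sum>x\<in>tuples n m. if x = exchange k y then f x * braid_coeff t (x k) (x (k + 1)) else 0)"
    using f by (auto simp: braid_operator_def sum_fun_apply fun_scale_def basis_vector_def intro!: sum.cong)
  also have "\<dots> = (if exchange k y \<in> tuples n m
      then f (exchange k y) * braid_coeff t (exchange k y k) (exchange k y (k + 1)) else 0)"
    by (simp add: finite_tuples)
  also have "\<dots> = braid_coeff t (y k) (y (k + 1)) * f (exchange k y)"
    using f by (auto simp: braid_space_def exchange_def braid_coeff_def)
  finally show ?thesis .
qed

lemma braid_operator_in_space:
  "k \<in> braid_generators n \<Longrightarrow> f \<in> braid_space n m \<Longrightarrow> braid_operator n m t k f \<in> braid_space n m"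
  using exchange_tuples_iff[of k n _ m]
  by (auto simp: braid_operator_apply braid_space_def[of n m])

lemma braid_operator_aut:
  assumes k: "k \<in> braid_generators n" and t: "t \<noteq> 0"
  shows "braid_operator n m t k \<in> carrier (linear_aut_group fun_scale (braid_space n m))"
proof -
  let ?V = "braid_space n m" and ?T = "braid_operator n m t k"
  let ?U = "\<lambda>f y. f (exchange k y) / braid_coeff t (y k) (y (k + 1))"
  have nz: "braid_coeff t a b \<noteq> 0" for a b using t by (simp add: braid_coeff_def)
  have sw: "braid_coeff t (exchange k y k) (exchange k y (k + 1)) = braid_coeff t (y k) (y (k + 1))" for y
    by (simp add: exchange_def braid_coeff_def)
  have U: "?U f \<in> ?V" if "f \<in> ?V" for f
    using that exchange_tuples_iff[OF k] by (auto simp: braid_space_def)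
  have "bij_betw ?T ?V ?V"
  proof (rule bij_betw_byWitness[where f' = ?U])
    show "\<forall>f\<in>?V. ?U (?T f) = f"
      using nz sw by (auto simp del: One_nat_def add_Suc_right simp: braid_operator_apply[OF k])
    show "\<forall>f\<in>?V. ?T (?U f) = f"
      using nz sw U by (auto simp del: One_nat_def add_Suc_right simp: braid_operator_apply[OF k] fun_eq_iff)
    show "?T ` ?V \<subseteq> ?V" using braid_operator_in_space[OF k] by auto
    show "?U ` ?V \<subseteq> ?V" using U by auto
  qed
  moreover have "?T \<in> extensional ?V" by (simp add: braid_operator_def)
  moreover have "?T (f + h) = ?T f + ?T h" if "f \<in> ?V" "h \<in> ?V" for f h
    using that fun_space.subspace_add[OF subspace_braid_space that]
    by (auto simp: braid_operator_apply[OF k] algebra_simps)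
  moreover have "?T (fun_scale c f) = fun_scale c (?T f)" if "f \<in> ?V" for c f
  proof
    fix y
    show "?T (fun_scale c f) y = fun_scale c (?T f) y"
      using that fun_space.subspace_scale[OF subspace_braid_space that, of c]
      by (simp add: braid_operator_apply[OF k] fun_scale_def)
  qed
  ultimately show ?thesis by (simp add: linear_aut_group_def Bij_def)
qed

lemma linear_aut_group_mult:
  assumes "f \<in> carrier (linear_aut_group s V)" "h \<in> carrier (linear_aut_group s V)"
  shows "f \<otimes>\<^bsub>linear_aut_group s V\<^esub> h = compose V f h"
  using assms by (simp add: linear_aut_group_def BijGroup_def)

lemma braid_operator_relations:
  fixes n m :: nat
  assumes t: "t \<noteq> 0" and R: "(l, r) \<in> braid_relations n"
  defines "H \<equiv> linear_aut_group fun_scale (braid_space n m)"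
  shows "word_value H (braid_operator n m t) l = word_value H (braid_operator n m t) r"
proof -
  let ?V = "braid_space n m" and ?T = "braid_operator n m t"
  interpret H: group H unfolding H_def by (rule group_linear_aut_group[OF vector_space_fun_scale subspace_braid_space])
  have T: "?T k \<in> carrier H" if "k \<in> braid_generators n" for k
    unfolding H_def by (rule braid_operator_aut[OF that t])
  have mult: "a \<otimes>\<^bsub>H\<^esub> b = compose ?V a b" if "a \<in> carrier H" "b \<in> carrier H" for a b
    using that unfolding H_def by (rule linear_aut_group_mult)
  note [simp] = compose_eq braid_operator_in_space
  from R consider
      (comm) k j where "l = [(k, True), (j, True)]" "r = [(j, True), (k, True)]"
        "k \<in> braid_generators n" "j \<in> braid_generators n" "\<bar>int k - int j\<bar> > 1"
    | (braid) k where "l = [(k, True), (k + 1, True), (k, True)]"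
        "r = [(k + 1, True), (k, True), (k + 1, True)]"
        "k \<in> braid_generators n" "k + 1 \<in> braid_generators n"
    unfolding braid_relations_def braid_generators_def by auto
  then show ?thesis
  proof cases
    case comm
    have "compose ?V (?T k) (?T j) f y = compose ?V (?T j) (?T k) f y" for f y
    proof (cases "f \<in> ?V")
      case True
      have "exchange j (exchange k y) = exchange k (exchange j y)"
        using comm(5) by (auto simp: exchange_def fun_eq_iff)
      moreover have "exchange k y j = y j" "exchange k y (j + 1) = y (j + 1)"
        "exchange j y k = y k" "exchange j y (k + 1) = y (k + 1)"
        using comm(5) by (auto simp: exchange_def)
      ultimately show ?thesis
        using True comm(3,4) by (simp del: One_nat_def add_Suc_right add: braid_operator_apply)
    qed (simp add: compose_def)
    then have "compose ?V (?T k) (?T j) = compose ?V (?T j) (?T k)" by blast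
    then show ?thesis using comm T by (simp add: mult)
  next
    case braid
    let ?j = "k + 1"
    have "compose ?V (?T k) (compose ?V (?T ?j) (?T k)) f y =
        compose ?V (?T ?j) (compose ?V (?T k) (?T ?j)) f y" for f y
    proof (cases "f \<in> ?V")
      case True
      have "exchange k (exchange ?j (exchange k y)) = exchange ?j (exchange k (exchange ?j y))"
        by (auto simp: exchange_def fun_eq_iff)
      moreover have "exchange k y ?j = y k" "exchange k y (?j + 1) = y (?j + 1)"
        "exchange ?j y k = y k" "exchange ?j y ?j = y (?j + 1)"
        "exchange ?j (exchange k y) k = y ?j" "exchange ?j (exchange k y) ?j = y (?j + 1)"
        "exchange k (exchange ?j y) ?j = y k" "exchange k (exchange ?j y) (?j + 1) = y ?j"
        by (auto simp: exchange_def)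
      ultimately show ?thesis
        using True braid(3,4) by (simp del: One_nat_def add_Suc_right add: braid_operator_apply)
    qed (simp add: compose_def)
    then have *: "compose ?V (?T k) (compose ?V (?T ?j) (?T k)) =
        compose ?V (?T ?j) (compose ?V (?T k) (?T ?j))" by blast
    have "compose ?V (?T ?j) (?T k) \<in> carrier H" "compose ?V (?T k) (?T ?j) \<in> carrier H"
      using H.m_closed[OF T T] mult[OF T T] braid(3,4) by metis+
    then show ?thesis using braid T * by (simp del: One_nat_def add_Suc_right add: mult)
  qed
qed

lemma braid_rep_generator:
  assumes "t \<noteq> 0" "k \<in> braid_generators n"
  shows "braid_rep n m t (braid_generator n k) = braid_operator n m t k"
proof -
  let ?H = "linear_aut_group fun_scale (braid_space n m)"
  interpret H: group ?H by (rule group_linear_aut_group[OF vector_space_fun_scale subspace_braid_space])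
  have "braid_rep n m t (braid_generator n k) = word_value ?H (braid_operator n m t) [(k, True)]"
    unfolding braid_rep_def braid_generator_def
    by (rule presentation_lift_class[OF H.group_axioms])
       (use assms braid_operator_aut braid_operator_relations in \<open>auto simp: group_words_def\<close>)
  then show ?thesis using braid_operator_aut assms by simp
qed

lemma braid_rep_basis_vector:
  assumes "t \<noteq> 0" "k \<in> {1..n - 1}" "x \<in> tuples n m"
  shows "braid_rep n m t (braid_generator n k) (basis_vector x) =
    fun_scale (if x k = x (k + 1) then 1 else complex_of_real t) (basis_vector (exchange k x))"
proof
  fix y
  have k: "k \<in> braid_generators n" using assms(2) by (simp add: braid_generators_def)
  have "exchange k y = x \<longleftrightarrow> y = exchange k x" by auto
  moreover have "exchange k x k = x (k + 1)" "exchange k x (k + 1) = x k"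
    by (simp_all add: exchange_def)
  ultimately show "braid_rep n m t (braid_generator n k) (basis_vector x) y =
      fun_scale (if x k = x (k + 1) then 1 else complex_of_real t) (basis_vector (exchange k x)) y"
    using braid_rep_generator[OF assms(1) k] braid_operator_apply[OF k basis_vector_in_space[OF assms(3)]]
    by (auto simp del: One_nat_def add_Suc_right simp: basis_vector_def fun_scale_def braid_coeff_def)
qed

lemma representation_braid_rep:
  assumes t: "t \<noteq> 0"
  shows "representation (braid_group n) fun_scale (braid_space n m) (braid_rep n m t)"
proof -
  let ?H = "linear_aut_group fun_scale (braid_space n m)"
  have "braid_rep n m t \<in> hom (braid_group n) ?H"
    unfolding braid_rep_def braid_group_def
  proof (rule presentation_lift_hom)
    show "group ?H" by (rule group_linear_aut_group[OF vector_space_fun_scale subspace_braid_space])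
    show "braid_operator n m t ` braid_generators n \<subseteq> carrier ?H"
      by (rule image_subsetI) (rule braid_operator_aut[OF _ t])
    show "word_value ?H (braid_operator n m t) l = word_value ?H (braid_operator n m t) r"
      if "(l, r) \<in> braid_relations n" for l r
      by (rule braid_operator_relations[OF t that])
  qed
  moreover have "\<exists>B. finite B \<and> fun_space.span B = braid_space n m"
    by (rule exI[of _ "basis_vector ` tuples n m"]) (simp add: span_basis_vectors finite_tuples)
  moreover have "group (braid_group n)"
    unfolding braid_group_def by (rule group_presented_group)
  ultimately show ?thesis
    unfolding representation_def by (intro conjI vector_space_fun_scale subspace_braid_space)
qed

end

(* Since t^2 \<noteq> 1, the square of the operator of tau_k, which is diagonal with entries 1 and t^2,
   generates the projection onto the vectors supported on x_k = x_{k+1}; removing the factor t then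
   shows that the algebra generated by the braid group contains the plain permutation action. By
   conjugation it contains the projections onto x_i = x_j for all i and j. Together these separate
   tuples up to exchanging 0 and 1, so a nonzero invariant subspace contains a vector supported on
   one tuple x and its complement. For 2m \<noteq> n the complement is not in X_m. For n = 2m the
   complementation commutes with the braid group, and its two eigenspaces are the irreducible
   summands. *)
theory Submission
  imports Defs
begin

section \<open>0-1 tuples: complementation and transitivity of the adjacent exchanges\<close>

section \<open>Tuples\<close>

text \<open>The restriction to \<open>{1..n}\<close> keeps the result extensional, so that it can
  lie in \<open>tuples\<close>.\<close>

definition tuple_complement :: "nat \<Rightarrow> (nat \<Rightarrow> nat) \<Rightarrow> nat \<Rightarrow> nat" where
  "tuple_complement n x = (\<lambda>i\<in>{1..n}. 1 - x i)"

lemma tuples_cases: "x \<in> tuples n m \<Longrightarrow> i \<in> {1..n} \<Longrightarrow> x i = 0 \<or> x i = 1"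
  by (auto simp: tuples_def PiE_iff)

lemma tuples_extensionality:
  assumes "x \<in> tuples n m" "y \<in> tuples n m'" "\<And>i. i \<in> {1..n} \<Longrightarrow> x i = y i"
  shows "x = y"
  using assms by (auto simp: tuples_def PiE_iff intro: extensionalityI)

lemma tuples_nonempty:
  assumes "m \<le> n"
  shows "tuples n m \<noteq> {}"
proof -
  let ?x = "\<lambda>i\<in>{1..n}. if i \<le> m then 1 else 0 :: nat"
  have "{i \<in> {1..n}. ?x i = 1} = {1..m}" using assms by auto
  then have "?x \<in> tuples n m" by (auto simp: tuples_def)
  then show ?thesis by blast
qed

lemma tuple_complement_tuples:
  assumes "x \<in> tuples n m"
  shows "tuple_complement n x \<in> tuples n (n - m)"
proof -
  have "{i \<in> {1..n}. tuple_complement n x i = 1} = {1..n} - {i \<in> {1..n}. x i = 1}"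
    using tuples_cases[OF assms] by (fastforce simp: tuple_complement_def)
  also have "card \<dots> = n - m"
    using assms by (subst card_Diff_subset) (auto simp: tuples_def)
  finally show ?thesis
    by (auto simp: tuples_def) (auto simp: tuple_complement_def)
qed

lemma tuple_complement_tuple_complement:
  assumes "x \<in> tuples n m"
  shows "tuple_complement n (tuple_complement n x) = x"
  using tuples_cases[OF assms]
  by (intro tuples_extensionality[OF tuple_complement_tuples[OF tuple_complement_tuples[OF assms]] assms])
     (fastforce simp: tuple_complement_def)

lemma tuple_complement_neq:
  assumes "1 \<le> n"
  shows "tuple_complement n x \<noteq> x"
proof
  assume "tuple_complement n x = x"
  then have "tuple_complement n x 1 = x 1" by simp
  then have "1 - x 1 = x 1" using assms by (simp add: tuple_complement_def)
  \<comment> \<open>Subtraction is truncated and \<open>x\<close> is arbitrary: \<open>1 - a\<close>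
    is 1 for \<open>a = 0\<close> and 0 for \<open>a \<ge> 1\<close>, hence never
    \<open>a\<close>.\<close>
  then show False by arith
qed

text \<open>Both \<open>k\<close> and \<open>k + 1\<close> lie in \<open>{1..n}\<close>, so the
  exchange does not cross the boundary of the restriction.\<close>

lemma tuple_complement_exchange:
  "k \<in> braid_generators n \<Longrightarrow>
    tuple_complement n (exchange k x) = exchange k (tuple_complement n x)"
  by (auto simp: tuple_complement_def exchange_def braid_generators_def fun_eq_iff)

text \<open>Comparison with the first coordinate determines a 0-1 tuple once that coordinate is
  known; its two possible values give \<open>x\<close> and its complement.\<close>

lemma same_equalities_imp_eq_or_complement:
  assumes x: "x \<in> tuples n m" and y: "y \<in> tuples n m'" and n: "1 \<le> n"
    and eq: "\<And>i. i \<in> {1..n} \<Longrightarrow> y 1 = y i \<longleftrightarrow> x 1 = x i"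
  shows "y = x \<or> y = tuple_complement n x"
proof -
  have 1: "1 \<in> {1..n}" using n by simp
  have bits: "x i = 0 \<or> x i = 1" "y i = 0 \<or> y i = 1" if "i \<in> {1..n}" for i
    using tuples_cases[OF x that] tuples_cases[OF y that] by auto
  show ?thesis
  proof (cases "y 1 = x 1")
    case True
    have "y i = x i" if "i \<in> {1..n}" for i
      using bits[OF that] bits[OF 1] eq[OF that] True by force
    then show ?thesis using tuples_extensionality[OF y x] by blast
  next
    case False
    have "y i = tuple_complement n x i" if "i \<in> {1..n}" for i
      using bits[OF that] bits[OF 1] eq[OF that] False that
      by (simp add: tuple_complement_def) linarith
    then show ?thesis using tuples_extensionality[OF y tuple_complement_tuples[OF x]] by blast
  qed
qed

text \<open>Every transposition is a product of adjacent ones. The set \<open>S\<close> is arbitrary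
  because it serves both for \<open>tuples n m\<close> and for sets of tuples whose associated
  vectors lie in a given subspace.\<close>

lemma exchange_closed_swap:
  fixes S :: "(nat \<Rightarrow> nat) set"
  assumes S: "\<And>k x. k \<in> braid_generators n \<Longrightarrow> x \<in> S \<Longrightarrow> exchange k x \<in> S"
    and "i \<in> {1..n}" "j \<in> {1..n}" "i \<noteq> j" "x \<in> S"
  shows "x(i := x j, j := x i) \<in> S"
proof -
  have less: "x(i := x j, j := x i) \<in> S" if "Suc i \<le> j" "1 \<le> i" "j \<le> n" "x \<in> S" for i j x
    using that
  proof (induction j arbitrary: x rule: dec_induct)
    case base
    then have "exchange i x \<in> S" by (intro S) (auto simp: braid_generators_def)
    then show ?case unfolding exchange_def Suc_eq_plus1 .
  next
    case (step j)
    have j: "j \<in> braid_generators n" using step by (auto simp: braid_generators_def)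
    let ?y = "exchange j x"
    \<comment> \<open>Conjugation by \<open>exchange j\<close> carries the swap of \<open>i\<close>
      and \<open>j\<close> to the swap of \<open>i\<close> and \<open>j + 1\<close>.\<close>
    have "exchange j (?y(i := ?y j, j := ?y i)) \<in> S"
      using step j by (intro S step.IH) auto
    also have "exchange j (?y(i := ?y j, j := ?y i)) = x(i := x (Suc j), Suc j := x i)"
      using step by (auto simp: exchange_def fun_eq_iff)
    finally show ?case .
  qed
  show ?thesis
  proof (cases "i < j")
    case True
    then show ?thesis using less[of i j x] assms by auto
  next
    case False
    then have "x(j := x i, i := x j) \<in> S" using less[of j i x] assms by auto
    then show ?thesis using assms by (simp add: fun_upd_twist)
  qed
qed

text \<open>Induction on the number of coordinates where \<open>x\<close> and \<open>y\<close>
  disagree: as both have \<open>m\<close> ones, a surplus one of \<open>x\<close> can be swapped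
  with a missing one, which repairs two disagreements.\<close>

lemma exchange_closed_contains_tuples:
  assumes S: "\<And>k x. k \<in> braid_generators n \<Longrightarrow> x \<in> S \<Longrightarrow> exchange k x \<in> S"
    and x: "x \<in> S" "x \<in> tuples n m" and y: "y \<in> tuples n m"
  shows "y \<in> S"
  using x
proof (induction "card {i \<in> {1..n}. x i \<noteq> y i}" arbitrary: x rule: less_induct)
  case less
  show ?case
  proof (cases "x = y")
    case True
    then show ?thesis using less by simp
  next
    case False
    let ?A = "{i \<in> {1..n}. x i = 1}" and ?B = "{i \<in> {1..n}. y i = 1}"
    have card: "card ?A = card ?B" using less(3) y by (simp add: tuples_def)
    have "?A \<noteq> ?B"
    proof
      assume AB: "?A = ?B"
      have "x i = y i" if i: "i \<in> {1..n}" for i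
      proof -
        have "i \<in> ?A \<longleftrightarrow> i \<in> ?B" by (simp only: AB)
        then have "x i = 1 \<longleftrightarrow> y i = 1" using i by simp
        then show ?thesis using tuples_cases[OF less(3) i] tuples_cases[OF y i] by auto
      qed
      then have "x = y" by (rule tuples_extensionality[OF less(3) y])
      then show False using False by simp
    qed
    \<comment> \<open>Finite sets of equal cardinality coincide as soon as one contains the
      other.\<close>
    then have "\<not> ?A \<subseteq> ?B" "\<not> ?B \<subseteq> ?A"
      using card_subset_eq[of ?B ?A] card_subset_eq[of ?A ?B] card by auto
    then obtain i j where i: "i \<in> {1..n}" "x i = 1" "y i \<noteq> 1"
      and j: "j \<in> {1..n}" "x j \<noteq> 1" "y j = 1" by auto
    have 0: "y i = 0" "x j = 0"
      using tuples_cases[OF y i(1)] tuples_cases[OF less(3) j(1)] i j by auto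
    have ij: "i \<noteq> j" using i j by auto
    let ?z = "x(i := x j, j := x i)"
    have zS: "?z \<in> S" using exchange_closed_swap[OF S i(1) j(1) ij less(2)] by blast
    \<comment> \<open>Here the closed set is \<open>tuples n m\<close> itself.\<close>
    have zt: "?z \<in> tuples n m"
      using exchange_closed_swap[OF exchange_tuples i(1) j(1) ij less(3)] by blast
    have z: "?z i = y i" "?z j = y j" "l \<noteq> i \<Longrightarrow> l \<noteq> j \<Longrightarrow> ?z l = x l" for l
      using i j 0 ij by simp_all
    have "x i \<noteq> y i" using i by simp
    then have "i \<in> {l \<in> {1..n}. x l \<noteq> y l} - {l \<in> {1..n}. ?z l \<noteq> y l}"
      using i(1) z(1) by blast
    moreover have "{l \<in> {1..n}. ?z l \<noteq> y l} \<subseteq> {l \<in> {1..n}. x l \<noteq> y l}"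
    proof
      fix l assume l: "l \<in> {l \<in> {1..n}. ?z l \<noteq> y l}"
      then have "l \<noteq> i" "l \<noteq> j" using z(1,2) by blast+
      then show "l \<in> {l \<in> {1..n}. x l \<noteq> y l}" using l z(3)[of l] by simp
    qed
    ultimately have "{l \<in> {1..n}. ?z l \<noteq> y l} \<subset> {l \<in> {1..n}. x l \<noteq> y l}" by blast
    then have "card {l \<in> {1..n}. ?z l \<noteq> y l} < card {l \<in> {1..n}. x l \<noteq> y l}"
      by (intro psubset_card_mono) auto
    then show ?thesis using less(1) zS zt by blast
  qed
qed


section \<open>Projections and permutations from the braid operators; the case
  \<open>2 * m \<noteq> n\<close>\<close>

section \<open>Subspaces closed under the braid operators\<close>

text \<open>Closure is phrased by the explicit operators of the generators, so the arguments avoid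
  braid words. It covers the invariant subspaces of the whole space and those contained in an
  eigenspace of the complementation.\<close>

locale braid_closed_subspace =
  fixes n m :: nat and t :: real and W :: "((nat \<Rightarrow> nat) \<Rightarrow> complex) set"
  assumes t: "t \<noteq> 0" "t \<noteq> 1" "t \<noteq> - 1"
    and subspace: "fun_space.subspace W"
    and subset: "W \<subseteq> braid_space n m"
    and closed: "k \<in> braid_generators n \<Longrightarrow> f \<in> W \<Longrightarrow> braid_operator n m t k f \<in> W"
begin

lemmas add = fun_space.subspace_add[OF subspace]
lemmas diff = fun_space.subspace_diff[OF subspace]
lemmas scale = fun_space.subspace_scale[OF subspace]

text \<open>With \<open>T\<close> the operator of \<open>k\<close>, the projection is
  \<open>(T^2 - t^2) / (1 - t^2)\<close>.\<close>

lemma project_adjacent: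
  assumes k: "k \<in> braid_generators n" and f: "f \<in> W"
  shows "(\<lambda>y. if y k = y (k + 1) then f y else 0) \<in> W"
proof -
  let ?T = "braid_operator n m t k" and ?c = "complex_of_real t ^ 2"
  \<comment> \<open>The hypotheses \<open>t \<noteq> 1\<close> and \<open>t \<noteq> - 1\<close>
    make the denominator nonzero.\<close>
  have "t\<^sup>2 \<noteq> 1" using t by (simp add: power2_eq_1_iff)
  then have c: "1 - ?c \<noteq> 0" by (metis of_real_1 of_real_eq_iff of_real_power right_minus_eq)
  \<comment> \<open>The coefficient is symmetric in its two coordinates and the exchange is an
    involution, so the square is diagonal.\<close>
  have TT: "?T (?T f) y = braid_coeff t (y k) (y (k + 1)) ^ 2 * f y" for y
  proof -
    have "?T f \<in> braid_space n m" "f \<in> braid_space n m" using closed[OF k] f subset by auto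
    moreover have "braid_coeff t (exchange k y k) (exchange k y (k + 1)) =
        braid_coeff t (y k) (y (k + 1))"
      by (simp add: exchange_def braid_coeff_def)
    ultimately show ?thesis
      by (simp del: One_nat_def add_Suc_right add: braid_operator_apply[OF k] power2_eq_square)
  qed
  have "fun_scale (inverse (1 - ?c)) (?T (?T f) - fun_scale ?c f) \<in> W"
    by (intro scale diff closed k f)
  also have "fun_scale (inverse (1 - ?c)) (?T (?T f) - fun_scale ?c f) =
      (\<lambda>y. if y k = y (k + 1) then f y else 0)"
  proof
    fix y
    have "inverse (1 - ?c) * (f y - ?c * f y) = f y"
      using c by (simp add: field_simps)
    then show "fun_scale (inverse (1 - ?c)) (?T (?T f) - fun_scale ?c f) y =
        (if y k = y (k + 1) then f y else 0)"
      by (simp del: One_nat_def add_Suc_right add: fun_scale_def TT) (simp add: braid_coeff_def)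
  qed
  finally show ?thesis .
qed

text \<open>Dividing \<open>?T f\<close> by \<open>t\<close> is right where
  \<open>y k \<noteq> y (k + 1)\<close>; elsewhere it leaves the factor \<open>1 / t\<close>, which
  adding \<open>1 - 1 / t\<close> times the projection of \<open>?T f\<close> corrects to 1.\<close>

lemma permute_adjacent:
  assumes k: "k \<in> braid_generators n" and f: "f \<in> W"
  shows "(\<lambda>y. f (exchange k y)) \<in> W"
proof -
  let ?T = "braid_operator n m t k" and ?c = "inverse (complex_of_real t)"
  have fV: "f \<in> braid_space n m" using f subset by auto
  have "fun_scale ?c (?T f) + fun_scale (1 - ?c) (\<lambda>y. if y k = y (k + 1) then ?T f y else 0) \<in> W"
    by (intro add scale project_adjacent closed k f)
  also have "fun_scale ?c (?T f) + fun_scale (1 - ?c) (\<lambda>y. if y k = y (k + 1) then ?T f y else 0) =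
      (\<lambda>y. f (exchange k y))"
    using t by (auto simp del: One_nat_def add_Suc_right
      simp: fun_eq_iff fun_scale_def braid_operator_apply[OF k fV] braid_coeff_def algebra_simps)
  finally show ?thesis .
qed

text \<open>Conjugating by \<open>exchange j\<close> turns the condition on \<open>i, j\<close> into
  the one on \<open>i, j + 1\<close>.\<close>

lemma project_pair:
  assumes "Suc i \<le> j" "1 \<le> i" "j \<le> n" "f \<in> W"
  shows "(\<lambda>y. if y i = y j then f y else 0) \<in> W"
  using assms
proof (induction j arbitrary: f rule: dec_induct)
  case base
  then show ?case using project_adjacent[of i f] by (simp add: braid_generators_def)
next
  case (step j)
  have j: "j \<in> braid_generators n" using step by (auto simp: braid_generators_def)
  \<comment> \<open>The induction hypothesis is applied to the permuted \<open>f\<close>, so that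
    the second exchange restores \<open>f\<close>.\<close>
  have "(\<lambda>y. if y i = y j then f (exchange j y) else 0) \<in> W"
    using step by (intro step.IH permute_adjacent j) auto
  from permute_adjacent[OF j this]
  have "(\<lambda>y. if exchange j y i = exchange j y j then f y else 0) \<in> W"
    by (simp cong: if_cong)
  moreover have "exchange j y i = y i" "exchange j y j = y (Suc j)" for y
    using step by (auto simp: exchange_def)
  ultimately show ?case by simp
qed

text \<open>The projections are composed over \<open>i \<in> A\<close>, choosing for each
  \<open>i\<close> the projection onto \<open>y 1 = y i\<close> or its complement, according to
  \<open>x\<close>.\<close>

lemma project_same_equalities:
  assumes "finite A" "A \<subseteq> {1..n}" "f \<in> W"
  shows "(\<lambda>y. if \<forall>i\<in>A. y 1 = y i \<longleftrightarrow> x 1 = x i then f y else 0) \<in> W"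
  using assms(1,2)
proof (induction A)
  case empty
  then show ?case using assms by simp
next
  case (insert i A)
  let ?g = "\<lambda>y. if \<forall>i\<in>A. y 1 = y i \<longleftrightarrow> x 1 = x i then f y else 0"
  have g: "?g \<in> W" using insert by simp
  have p: "(\<lambda>y. if y 1 = y i then ?g y else 0) \<in> W"
    \<comment> \<open>For \<open>i = 1\<close> the condition is vacuous and the function is
      \<open>?g\<close> itself.\<close>
    using project_pair[of 1 i ?g] g insert by (cases "i = 1") auto
  show ?case
  proof (cases "x 1 = x i")
    case True
    have "(\<lambda>y. if y 1 = y i then ?g y else 0) =
        (\<lambda>y. if \<forall>i\<in>insert i A. y 1 = y i \<longleftrightarrow> x 1 = x i then f y else 0)"
      using True by auto
    with p show ?thesis by simp
  next
    case False
    \<comment> \<open>Subtracting the projection leaves the part with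
      \<open>y 1 \<noteq> y i\<close>.\<close>
    have "?g - (\<lambda>y. if y 1 = y i then ?g y else 0) =
        (\<lambda>y. if \<forall>i\<in>insert i A. y 1 = y i \<longleftrightarrow> x 1 = x i then f y else 0)"
      using False by (auto simp: fun_eq_iff)
    with diff[OF g p] show ?thesis by simp
  qed
qed

lemma project_complementary_pair:
  assumes x: "x \<in> tuples n m" and n: "1 \<le> n" and f: "f \<in> W"
  shows "(\<lambda>y. if y = x \<or> y = tuple_complement n x then f y else 0) \<in> W"
proof -
  have "(if \<forall>i\<in>{1..n}. y 1 = y i \<longleftrightarrow> x 1 = x i then f y else 0) =
      (if y = x \<or> y = tuple_complement n x then f y else 0)" for y
  proof (cases "y \<in> tuples n m")
    case True
    have "tuple_complement n x 1 = tuple_complement n x i \<longleftrightarrow> x 1 = x i" if "i \<in> {1..n}" for i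
      using tuples_cases[OF x that] tuples_cases[OF x, of 1] that n
      by (auto simp: tuple_complement_def)
    then have "(\<forall>i\<in>{1..n}. y 1 = y i \<longleftrightarrow> x 1 = x i) \<longleftrightarrow> y = x \<or> y = tuple_complement n x"
      using same_equalities_imp_eq_or_complement[OF x True n] by blast
    then show ?thesis by (rule if_cong) simp_all
  next
    case False
    \<comment> \<open>Outside \<open>tuples n m\<close> the two masks may differ, but
      \<open>f\<close> vanishes there.\<close>
    then have fy: "f y = 0" using f subset by (auto simp: braid_space_def)
    show ?thesis unfolding fy by simp
  qed
  with project_same_equalities[of "{1..n}" f x] f show ?thesis by simp
qed

text \<open>Projecting a nonzero \<open>f\<close> around a point \<open>x\<close> of its support
  isolates a multiple of \<open>basis_vector x\<close>; transitivity of the exchanges then yields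
  all basis vectors.\<close>

lemma eq_braid_space:
  assumes "1 \<le> n" "2 * m \<noteq> n" "W \<noteq> {0}"
  shows "W = braid_space n m"
proof -
  have "0 \<in> W" using subspace by (rule fun_space.subspace_0)
  with assms obtain f where f: "f \<in> W" "f \<noteq> 0" by blast
  then obtain x where fx: "f x \<noteq> 0" by (auto simp: fun_eq_iff)
  then have x: "x \<in> tuples n m" using f subset by (auto simp: braid_space_def)
  have "m \<le> n"
    using x card_mono[of "{1..n}" "{i \<in> {1..n}. x i = 1}"]
    by (force simp: tuples_def simp del: One_nat_def)
  \<comment> \<open>The complement has \<open>n - m\<close> ones, which differs from
    \<open>m\<close>.\<close>
  then have "tuple_complement n x \<notin> tuples n m"
    using tuple_complement_tuples[OF x] assms(2) by (auto simp: tuples_def)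
  then have "f (tuple_complement n x) = 0" using f subset by (auto simp: braid_space_def)
  then have "(\<lambda>y. if y = x \<or> y = tuple_complement n x then f y else 0) =
      fun_scale (f x) (basis_vector x)"
    by (intro ext) (auto simp: fun_scale_def basis_vector_def)
  with project_complementary_pair[OF x assms(1) f(1)]
  have "fun_scale (inverse (f x)) (fun_scale (f x) (basis_vector x)) \<in> W"
    by (intro scale[of "fun_scale _ _"]) simp
  then have "basis_vector x \<in> W" using fx by simp
  moreover have "basis_vector (exchange k z) \<in> W"
    if "k \<in> braid_generators n" "basis_vector z \<in> W" for k z
  proof -
    have eq: "exchange k y = z \<longleftrightarrow> y = exchange k z" for y by auto
    have "(\<lambda>y. basis_vector z (exchange k y)) = basis_vector (exchange k z)"
      by (simp add: basis_vector_def eq)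
    with permute_adjacent[OF that] show ?thesis by simp
  qed
  ultimately have "basis_vector y \<in> W" if "y \<in> tuples n m" for y
    using exchange_closed_contains_tuples[of n "{z. basis_vector z \<in> W}" x m y] x that by blast
  then have "fun_space.span (basis_vector ` tuples n m) \<subseteq> W"
    by (intro fun_space.span_minimal subspace) auto
  with subset show ?thesis by (simp add: span_basis_vectors)
qed

end


section \<open>The case \<open>n = 2 * m\<close>: splitting by complementation\<close>

section \<open>The eigenspaces of the complementation\<close>

text \<open>The condition ranges over tuples only: a function outside \<open>tuples\<close> can have
  a tuple as its complement, where \<open>f\<close> need not vanish.\<close>

definition complement_eigenspace :: "nat \<Rightarrow> complex \<Rightarrow> ((nat \<Rightarrow> nat) \<Rightarrow> complex) set" where
  "complement_eigenspace m \<epsilon> = {f \<in> braid_space (2 * m) m.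
    \<forall>y\<in>tuples (2 * m) m. f (tuple_complement (2 * m) y) = \<epsilon> * f y}"

text \<open>For \<open>\<epsilon> * \<epsilon> = 1\<close> and a tuple \<open>x\<close>, this is
  twice the projection of \<open>basis_vector x\<close> onto the eigenspace.\<close>

definition eigenvector_pair :: "nat \<Rightarrow> complex \<Rightarrow> (nat \<Rightarrow> nat) \<Rightarrow> (nat \<Rightarrow> nat) \<Rightarrow> complex" where
  "eigenvector_pair m \<epsilon> x =
    basis_vector x + fun_scale \<epsilon> (basis_vector (tuple_complement (2 * m) x))"

lemma tuple_complement_half:
  "x \<in> tuples (2 * m) m \<Longrightarrow> tuple_complement (2 * m) x \<in> tuples (2 * m) m"
  using tuple_complement_tuples[of x "2 * m" m] by simp

lemma subspace_complement_eigenspace: "fun_space.subspace (complement_eigenspace m \<epsilon>)"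
  by (auto simp: fun_space.subspace_def complement_eigenspace_def braid_space_def fun_scale_def
      algebra_simps)

lemma eigenvector_pair_in_eigenspace:
  assumes "\<epsilon> * \<epsilon> = 1" "x \<in> tuples (2 * m) m"
  shows "eigenvector_pair m \<epsilon> x \<in> complement_eigenspace m \<epsilon>"
proof -
  have "tuple_complement (2 * m) y = x \<longleftrightarrow> y = tuple_complement (2 * m) x"
    "tuple_complement (2 * m) y = tuple_complement (2 * m) x \<longleftrightarrow> y = x"
    if "y \<in> tuples (2 * m) m" for y
    using assms that tuple_complement_tuple_complement by metis+
  moreover have "\<epsilon> = 1 \<or> \<epsilon> = - 1" using assms(1) by (simp add: square_eq_1_iff)
  ultimately show ?thesis
    using assms tuple_complement_half[of x m]
    by (auto simp: complement_eigenspace_def braid_space_def eigenvector_pair_def fun_scale_def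
        basis_vector_def)
qed

text \<open>The factor 1/2 appears because \<open>x\<close> and its complement contribute the same
  term: the coefficient and the pair each change by \<open>\<epsilon>\<close>, and
  \<open>\<epsilon> * \<epsilon> = 1\<close>.\<close>

lemma eigenvector_pair_expansion:
  assumes \<epsilon>: "\<epsilon> * \<epsilon> = 1" and f: "f \<in> complement_eigenspace m \<epsilon>"
  shows "f = (\<Sum>x\<in>tuples (2 * m) m. fun_scale (f x / 2) (eigenvector_pair m \<epsilon> x))"
proof
  fix y
  let ?X = "tuples (2 * m) m" and ?c = "tuple_complement (2 * m)"
  have fV: "f \<in> braid_space (2 * m) m" using f by (simp add: complement_eigenspace_def)
  show "f y = (\<Sum>x\<in>?X. fun_scale (f x / 2) (eigenvector_pair m \<epsilon> x)) y"
  proof (cases "y \<in> ?X")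
    case True
    have eq: "y = ?c x \<longleftrightarrow> x = ?c y" if "x \<in> ?X" for x
      using that True tuple_complement_tuple_complement by metis
    have "(\<Sum>x\<in>?X. fun_scale (f x / 2) (eigenvector_pair m \<epsilon> x)) y =
        (\<Sum>x\<in>?X. (if x = y then f x / 2 else 0) + (if x = ?c y then \<epsilon> * f x / 2 else 0))"
      unfolding sum_fun_apply
      by (intro sum.cong) (auto simp: fun_scale_def eigenvector_pair_def basis_vector_def eq
          distrib_left)
    also have "\<dots> = f y / 2 + \<epsilon> * f (?c y) / 2"
      using True tuple_complement_half[OF True] by (simp add: sum.distrib finite_tuples)
    also have "\<epsilon> * f (?c y) = (\<epsilon> * \<epsilon>) * f y"
      using f True by (simp add: complement_eigenspace_def)
    finally show ?thesis by (simp add: \<epsilon>)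
  next
    case False
    then have "y \<noteq> x" "y \<noteq> ?c x" if "x \<in> ?X" for x
      using that tuple_complement_half by auto
    then have "(\<Sum>x\<in>?X. fun_scale (f x / 2) (eigenvector_pair m \<epsilon> x) y) = 0"
      by (intro sum.neutral) (auto simp: fun_scale_def eigenvector_pair_def basis_vector_def)
    then show ?thesis using fV False by (simp add: sum_fun_apply braid_space_def)
  qed
qed

lemma span_eigenvector_pairs:
  assumes "\<epsilon> * \<epsilon> = 1"
  shows "fun_space.span (eigenvector_pair m \<epsilon> ` tuples (2 * m) m) = complement_eigenspace m \<epsilon>"
proof
  show "fun_space.span (eigenvector_pair m \<epsilon> ` tuples (2 * m) m) \<subseteq> complement_eigenspace m \<epsilon>"
    using assms
    by (intro fun_space.span_minimal subspace_complement_eigenspace)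
       (auto simp: eigenvector_pair_in_eigenspace)
  show "complement_eigenspace m \<epsilon> \<subseteq> fun_space.span (eigenvector_pair m \<epsilon> ` tuples (2 * m) m)"
  proof
    fix f assume "f \<in> complement_eigenspace m \<epsilon>"
    then have "f = (\<Sum>x\<in>tuples (2 * m) m. fun_scale (f x / 2) (eigenvector_pair m \<epsilon> x))"
      by (rule eigenvector_pair_expansion[OF assms])
    also have "\<dots> \<in> fun_space.span (eigenvector_pair m \<epsilon> ` tuples (2 * m) m)"
      by (intro fun_space.span_sum fun_space.span_scale fun_space.span_base imageI)
    finally show "f \<in> fun_space.span (eigenvector_pair m \<epsilon> ` tuples (2 * m) m)" .
  qed
qed

lemma complement_eigenspace_nontrivial:
  assumes "1 \<le> m" "\<epsilon> * \<epsilon> = 1"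
  shows "complement_eigenspace m \<epsilon> \<noteq> {0}"
proof -
  obtain x where x: "x \<in> tuples (2 * m) m" using tuples_nonempty[of m "2 * m"] by auto
  \<comment> \<open>The second summand vanishes at \<open>x\<close> because \<open>x\<close> is not
    its own complement.\<close>
  have "eigenvector_pair m \<epsilon> x x = 1"
    using tuple_complement_neq[of "2 * m" x] assms(1)
    by (auto simp: eigenvector_pair_def basis_vector_def fun_scale_def)
  then have "eigenvector_pair m \<epsilon> x \<noteq> 0" by (metis zero_fun_apply zero_neq_one)
  then show ?thesis using eigenvector_pair_in_eigenspace[OF assms(2) x] by blast
qed

text \<open>The coefficient depends only on whether two coordinates agree, which complementation
  preserves, and complementation commutes with the exchange. The equivalence, rather than one
  implication, also handles inverse generators.\<close>

lemma braid_operator_eigenspace_iff: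
  assumes k: "k \<in> braid_generators (2 * m)" and t: "t \<noteq> 0" and f: "f \<in> braid_space (2 * m) m"
  shows "braid_operator (2 * m) m t k f \<in> complement_eigenspace m \<epsilon> \<longleftrightarrow>
    f \<in> complement_eigenspace m \<epsilon>"
proof -
  let ?X = "tuples (2 * m) m" and ?c = "tuple_complement (2 * m)" and ?e = "exchange k"
  let ?T = "braid_operator (2 * m) m t k"
  have kn: "k \<in> {1..2 * m}" "k + 1 \<in> {1..2 * m}" using k by (auto simp: braid_generators_def)
  have coeff: "braid_coeff t (?c y k) (?c y (k + 1)) = braid_coeff t (y k) (y (k + 1))"
    if "y \<in> ?X" for y
    using tuples_cases[OF that kn(1)] tuples_cases[OF that kn(2)] kn
    by (auto simp: braid_coeff_def tuple_complement_def)
  have nz: "braid_coeff t a b \<noteq> 0" for a b using t by (simp add: braid_coeff_def)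
  have "?T f (?c y) = \<epsilon> * ?T f y \<longleftrightarrow> f (?c (?e y)) = \<epsilon> * f (?e y)" if "y \<in> ?X" for y
    using nz that unfolding braid_operator_apply[OF k f] coeff[OF that]
    by (auto simp del: One_nat_def add_Suc_right simp: tuple_complement_exchange[OF k])
  then have "(\<forall>y\<in>?X. ?T f (?c y) = \<epsilon> * ?T f y) \<longleftrightarrow> (\<forall>y\<in>?X. f (?c (?e y)) = \<epsilon> * f (?e y))"
    by simp
  also have "\<dots> \<longleftrightarrow> (\<forall>y\<in>?X. f (?c y) = \<epsilon> * f y)"
    \<comment> \<open>The exchange permutes \<open>?X\<close>, so the bound variable may be replaced
      by its image.\<close>
    using exchange_tuples[OF k, of _ m] exchange_exchange by metis
  finally show ?thesis
    using f braid_operator_in_space[OF k f] by (simp add: complement_eigenspace_def)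
qed

text \<open>Now both \<open>x\<close> and its complement survive the projection, but
  \<open>f\<close> takes values in ratio \<open>\<epsilon>\<close> there, so the result is a
  multiple of one \<open>eigenvector_pair\<close>. Transitivity again gives a spanning set.\<close>

lemma (in braid_closed_subspace) eq_complement_eigenspace:
  assumes n: "n = 2 * m" and m: "1 \<le> m" and \<epsilon>: "\<epsilon> * \<epsilon> = 1"
    and W: "W \<subseteq> complement_eigenspace m \<epsilon>" "W \<noteq> {0}"
  shows "W = complement_eigenspace m \<epsilon>"
proof -
  have "0 \<in> W" using subspace by (rule fun_space.subspace_0)
  with W obtain f where f: "f \<in> W" "f \<noteq> 0" by blast
  then obtain x where fx: "f x \<noteq> 0" by (auto simp: fun_eq_iff)
  then have x: "x \<in> tuples n m" using f subset by (auto simp: braid_space_def)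
  have "f (tuple_complement n x) = \<epsilon> * f x"
    using f W x by (auto simp: complement_eigenspace_def n)
  moreover have "tuple_complement n x \<noteq> x" using tuple_complement_neq n m by simp
  ultimately have "(\<lambda>y. if y = x \<or> y = tuple_complement n x then f y else 0) =
      fun_scale (f x) (eigenvector_pair m \<epsilon> x)"
    by (intro ext) (auto simp: fun_scale_def eigenvector_pair_def basis_vector_def n)
  with project_complementary_pair[OF x _ f(1)] n m
  have "fun_scale (inverse (f x)) (fun_scale (f x) (eigenvector_pair m \<epsilon> x)) \<in> W"
    by (intro scale[of "fun_scale _ _"]) simp
  then have "eigenvector_pair m \<epsilon> x \<in> W" using fx by simp
  moreover have "eigenvector_pair m \<epsilon> (exchange k z) \<in> W"
    if "k \<in> braid_generators n" "eigenvector_pair m \<epsilon> z \<in> W" for k z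
  proof -
    have eq: "exchange k y = a \<longleftrightarrow> y = exchange k a" for y a by auto
    have "(\<lambda>y. eigenvector_pair m \<epsilon> z (exchange k y)) = eigenvector_pair m \<epsilon> (exchange k z)"
      using tuple_complement_exchange[OF that(1), of z]
      by (intro ext) (simp add: eigenvector_pair_def basis_vector_def fun_scale_def n eq)
    with permute_adjacent[OF that] show ?thesis by simp
  qed
  ultimately have "eigenvector_pair m \<epsilon> y \<in> W" if "y \<in> tuples n m" for y
    using exchange_closed_contains_tuples[of n "{z. eigenvector_pair m \<epsilon> z \<in> W}" x m y] x that
    by blast
  then have "fun_space.span (eigenvector_pair m \<epsilon> ` tuples (2 * m) m) \<subseteq> W"
    by (intro fun_space.span_minimal subspace) (auto simp: n)
  with W show ?thesis by (simp add: span_eigenvector_pairs[OF \<epsilon>])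
qed

lemma braid_space_decomposition:
  "braid_space (2 * m) m =
    {u + v | u v. u \<in> complement_eigenspace m 1 \<and> v \<in> complement_eigenspace m (- 1)}"
proof (intro Set.equalityI subsetI)
  fix f assume f: "f \<in> braid_space (2 * m) m"
  let ?X = "tuples (2 * m) m" and ?c = "tuple_complement (2 * m)"
  \<comment> \<open>Symmetric and antisymmetric parts of \<open>f\<close> under complementation, cut
    off outside \<open>?X\<close> to stay in the space.\<close>
  let ?u = "\<lambda>y. if y \<in> ?X then (f y + f (?c y)) / 2 else 0"
  let ?v = "\<lambda>y. if y \<in> ?X then (f y - f (?c y)) / 2 else 0"
  have "?u \<in> complement_eigenspace m 1" "?v \<in> complement_eigenspace m (- 1)"
    using tuple_complement_half tuple_complement_tuple_complement[of _ "2 * m" m]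
    by (auto simp: complement_eigenspace_def braid_space_def field_simps)
  moreover have "f = ?u + ?v"
    using f by (auto simp: fun_eq_iff braid_space_def field_simps)
  ultimately show
    "f \<in> {u + v | u v. u \<in> complement_eigenspace m 1 \<and> v \<in> complement_eigenspace m (- 1)}"
    by blast
qed (auto simp: complement_eigenspace_def intro!: fun_space.subspace_add[OF subspace_braid_space])

lemma complement_eigenspaces_Int:
  "complement_eigenspace m 1 \<inter> complement_eigenspace m (- 1) = {0}"
proof (intro Set.equalityI subsetI)
  fix f assume f: "f \<in> complement_eigenspace m 1 \<inter> complement_eigenspace m (- 1)"
  have "f y = 0" for y
  proof (cases "y \<in> tuples (2 * m) m")
    case True
    then have "f y = - f y" using f by (force simp: complement_eigenspace_def)
    then show ?thesis by simp
  qed (use f in \<open>auto simp: complement_eigenspace_def braid_space_def\<close>)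
  then show "f \<in> {0}" by (auto simp: fun_eq_iff)
qed (auto simp: fun_space.subspace_0[OF subspace_complement_eigenspace])


section \<open>Restricting a representation to an invariant subspace\<close>

section \<open>Invariant subspaces and subrepresentations\<close>

lemma representation_closed:
  assumes "representation G s V \<phi>" "x \<in> carrier G" "v \<in> V"
  shows "\<phi> x v \<in> V"
proof -
  have "\<phi> x \<in> Bij V" using assms by (auto simp: representation_def linear_aut_group_def hom_def)
  then show ?thesis using assms(3) by (auto dest: Bij_imp_funcset)
qed

lemma representation_mult:
  assumes "representation G s V \<phi>" "x \<in> carrier G" "y \<in> carrier G" "v \<in> V"
  shows "\<phi> (x \<otimes>\<^bsub>G\<^esub> y) v = \<phi> x (\<phi> y v)"
proof -
  have hom: "\<phi> \<in> hom G (linear_aut_group s V)" using assms(1) by (simp add: representation_def)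
  then have "\<phi> (x \<otimes>\<^bsub>G\<^esub> y) = compose V (\<phi> x) (\<phi> y)"
    using assms(2,3) by (simp add: hom_mult linear_aut_group_mult hom_in_carrier[OF hom])
  then show ?thesis using assms(4) by (simp add: compose_eq)
qed

lemma representation_one:
  assumes "representation G s V \<phi>" "v \<in> V"
  shows "\<phi> \<one>\<^bsub>G\<^esub> v = v"
proof -
  interpret G: group G using assms(1) by (simp add: representation_def)
  \<comment> \<open>The image of the unit is idempotent and injective, hence the identity on
    \<open>V\<close>.\<close>
  have one: "\<phi> \<one>\<^bsub>G\<^esub> (\<phi> \<one>\<^bsub>G\<^esub> v) = \<phi> \<one>\<^bsub>G\<^esub> v"
    using representation_mult[OF assms(1) G.one_closed G.one_closed assms(2)] by simp
  have "\<phi> \<one>\<^bsub>G\<^esub> \<in> Bij V"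
    using assms by (auto simp: representation_def linear_aut_group_def hom_def)
  then have "inj_on (\<phi> \<one>\<^bsub>G\<^esub>) V" by (simp add: Bij_def bij_betw_def)
  from inj_onD[OF this one] show ?thesis
    using representation_closed[OF assms(1) G.one_closed assms(2)] assms(2) by simp
qed

lemma representation_subrepresentation:
  assumes rep: "representation G s V \<phi>" and inv: "invariant_subspace G s V \<phi> W"
    and fin: "\<exists>B. finite B \<and> module.span s B = W"
  shows "representation G s W (subrepresentation \<phi> W)"
proof -
  let ?\<psi> = "subrepresentation \<phi> W"
  interpret G: group G using rep by (simp add: Defs.representation_def)
  interpret vector_space s using rep by (simp add: Defs.representation_def)
  have closed: "\<phi> x w \<in> W" if "x \<in> carrier G" "w \<in> W" for x w
    using inv that by (auto simp: invariant_subspace_def)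
  have sub: "subspace W" and WV: "W \<subseteq> V" using inv by (auto simp: invariant_subspace_def)
  have cancel: "\<phi> x (\<phi> y w) = w" if "x \<in> carrier G" "y \<in> carrier G" "x \<otimes>\<^bsub>G\<^esub> y = \<one>\<^bsub>G\<^esub>" "w \<in> W"
    for x y w
    using representation_mult[OF rep that(1,2), of w] representation_one[OF rep, of w] that WV by auto
  have aut: "?\<psi> x \<in> carrier (linear_aut_group s W)" if x: "x \<in> carrier G" for x
  proof -
    have "\<phi> x \<in> carrier (linear_aut_group s V)"
      using rep x by (auto simp: Defs.representation_def hom_def)
    then have lin: "\<forall>u\<in>V. \<forall>v\<in>V. \<phi> x (u + v) = \<phi> x u + \<phi> x v"
      "\<forall>c. \<forall>v\<in>V. \<phi> x (s c v) = s c (\<phi> x v)"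
      by (simp_all add: linear_aut_group_def)
    \<comment> \<open>Invariance under the inverse group element supplies the inverse map on
      \<open>W\<close>.\<close>
    have "bij_betw (?\<psi> x) W W"
      using x closed cancel
      by (intro bij_betw_byWitness[where f' = "\<phi> (inv\<^bsub>G\<^esub> x)"]) (auto simp: subrepresentation_def)
    then show ?thesis
      using lin WV subspace_add[OF sub] subspace_scale[OF sub]
      by (auto simp: linear_aut_group_def Bij_def subrepresentation_def subset_iff)
  qed
  have "?\<psi> \<in> hom G (linear_aut_group s W)"
  proof (rule homI)
    fix x y assume xy: "x \<in> carrier G" "y \<in> carrier G"
    have "?\<psi> (x \<otimes>\<^bsub>G\<^esub> y) = compose W (?\<psi> x) (?\<psi> y)"
      using representation_mult[OF rep xy] closed xy WV
      by (auto simp: subrepresentation_def compose_def fun_eq_iff)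
    then show "?\<psi> (x \<otimes>\<^bsub>G\<^esub> y) = ?\<psi> x \<otimes>\<^bsub>linear_aut_group s W\<^esub> ?\<psi> y"
      using linear_aut_group_mult[OF aut aut] xy by simp
  qed (rule aut)
  then show ?thesis
    unfolding Defs.representation_def
    by (intro conjI G.group_axioms vector_space_axioms sub fin)
qed

text \<open>On \<open>U\<close>, which lies in \<open>W\<close>, the restricted and original maps
  agree. This lets subspaces of a summand be treated as invariant subspaces of the whole
  space.\<close>

lemma invariant_subspace_subrepresentation:
  assumes "invariant_subspace G s W (subrepresentation \<phi> W) U" "W \<subseteq> V"
  shows "invariant_subspace G s V \<phi> U"
proof -
  have "subrepresentation \<phi> W x ` U = \<phi> x ` U" for x
    using assms(1) by (intro image_cong) (auto simp: invariant_subspace_def subrepresentation_def)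
  then show ?thesis using assms by (auto simp: invariant_subspace_def)
qed

section \<open>Passage between generators and the whole braid group; conclusion\<close>

lemma braid_generator_carrier:
  "k \<in> braid_generators n \<Longrightarrow> braid_generator n k \<in> carrier (braid_group n)"
  by (auto simp: braid_generator_def braid_group_def presented_group_def group_words_def)

lemma invariant_subspace_braid_closed:
  assumes "t \<noteq> 0" "t \<noteq> 1" "t \<noteq> - 1"
    and "invariant_subspace (braid_group n) fun_scale (braid_space n m) (braid_rep n m t) W"
  shows "braid_closed_subspace n m t W"
proof
  fix k f assume k: "k \<in> braid_generators n" and f: "f \<in> W"
  then have "braid_rep n m t (braid_generator n k) f \<in> W"
    using assms(4) braid_generator_carrier[OF k] by (auto simp: invariant_subspace_def)
  then show "braid_operator n m t k f \<in> W" using braid_rep_generator[OF assms(1) k] by simp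
qed (use assms in \<open>auto simp: invariant_subspace_def\<close>)

text \<open>Induction on the word; the direction of \<open>iff\<close> from
  \<open>g k v \<in> W\<close> to \<open>v \<in> W\<close> deals with formal inverses.\<close>

lemma word_value_invariant:
  fixes g :: "'a \<Rightarrow> 'v::ab_group_add \<Rightarrow> 'v"
  assumes "vector_space s" "module.subspace s V"
    and g: "g ` S \<subseteq> carrier (linear_aut_group s V)" and W: "W \<subseteq> V"
    and iff: "\<And>k v. k \<in> S \<Longrightarrow> v \<in> V \<Longrightarrow> g k v \<in> W \<longleftrightarrow> v \<in> W"
    and w: "w \<in> group_words S" and v: "v \<in> W"
  shows "word_value (linear_aut_group s V) g w v \<in> W"
proof -
  let ?H = "linear_aut_group s V"
  interpret H: group ?H by (rule group_linear_aut_group[OF assms(1,2)])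
  have one: "\<one>\<^bsub>?H\<^esub> = (\<lambda>v\<in>V. v)" by (simp add: linear_aut_group_def BijGroup_def)
  have funcset: "h v \<in> V" if "h \<in> carrier ?H" "v \<in> V" for h v
  proof -
    have "h \<in> Bij V" using that(1) by (simp add: linear_aut_group_def)
    then show ?thesis using that(2) by (auto dest: Bij_imp_funcset)
  qed
  show ?thesis
    using w
  proof (induction w)
    case Nil
    then show ?case using v W by (auto simp: one)
  next
    case (Cons l w)
    obtain a b where l: "l = (a, b)" by force
    let ?h = "if b then g a else inv\<^bsub>?H\<^esub> g a" and ?u = "word_value ?H g w v"
    have a: "a \<in> S" and w: "w \<in> group_words S" using Cons by (auto simp: group_words_def l)
    have ga: "g a \<in> carrier ?H" using g a by blast
    have h: "?h \<in> carrier ?H" using ga by simp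
    have u: "?u \<in> W" "?u \<in> V" using Cons w W by auto
    have "word_value ?H g w \<in> carrier ?H" using word_value_closed[OF H.group_axioms g w] .
    then have "word_value ?H g (l # w) v = ?h ?u"
      using linear_aut_group_mult[OF h] v W by (auto simp: l compose_eq)
    also have "?h ?u \<in> W"
    proof (cases b)
      case True
      then show ?thesis using iff[OF a] u by simp
    next
      case False
      \<comment> \<open>Applying \<open>g a\<close> to the inverse image of \<open>?u\<close>
        returns \<open>?u \<in> W\<close>, so \<open>iff\<close> puts that inverse image in
        \<open>W\<close>.\<close>
      have "g a \<otimes>\<^bsub>?H\<^esub> inv\<^bsub>?H\<^esub> g a = \<one>\<^bsub>?H\<^esub>" using ga by simp
      then have "compose V (g a) (inv\<^bsub>?H\<^esub> g a) = (\<lambda>v\<in>V. v)"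
        using linear_aut_group_mult[OF ga H.inv_closed[OF ga]] one by simp
      from fun_cong[OF this, of ?u] have "g a ((inv\<^bsub>?H\<^esub> g a) ?u) = ?u"
        using u by (simp add: compose_eq)
      then show ?thesis
        using iff[OF a funcset[OF H.inv_closed[OF ga] u(2)]] u(1) False by simp
    qed
    finally show ?case .
  qed
qed

lemma complement_eigenspace_invariant:
  assumes t: "t \<noteq> 0"
  shows "invariant_subspace (braid_group (2 * m)) fun_scale (braid_space (2 * m) m)
    (braid_rep (2 * m) m t) (complement_eigenspace m \<epsilon>)"
proof -
  let ?n = "2 * m" and ?W = "complement_eigenspace m \<epsilon>"
  let ?V = "braid_space ?n m" and ?T = "braid_operator ?n m t"
  let ?H = "linear_aut_group fun_scale ?V" and ?S = "braid_generators ?n"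
  have WV: "?W \<subseteq> ?V" by (auto simp: complement_eigenspace_def)
  have grp: "group ?H" by (rule group_linear_aut_group[OF vector_space_fun_scale subspace_braid_space])
  have T: "?T ` ?S \<subseteq> carrier ?H" by (rule image_subsetI) (rule braid_operator_aut[OF _ t])
  have "braid_rep ?n m t x f \<in> ?W" if x: "x \<in> carrier (braid_group ?n)" and f: "f \<in> ?W" for x f
  proof -
    obtain w where w: "w \<in> group_words ?S" "x = word_class ?S (braid_relations ?n) w"
      using x by (auto simp: braid_group_def presented_group_def)
    \<comment> \<open>The lift may be evaluated on any representing word, since the operators
      satisfy the braid relations.\<close>
    have "braid_rep ?n m t x = word_value ?H ?T w"
      unfolding braid_rep_def w(2)
      by (rule presentation_lift_class[OF grp T _ w(1)]) (rule braid_operator_relations[OF t])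
    with word_value_invariant[OF vector_space_fun_scale subspace_braid_space T WV _ w(1) f]
    show ?thesis using braid_operator_eigenspace_iff[OF _ t] by simp
  qed
  then show ?thesis
    using subspace_complement_eigenspace WV by (auto simp: invariant_subspace_def)
qed

lemma irreducible_complement_eigenspace:
  assumes t: "t \<noteq> 0" "t \<noteq> 1" "t \<noteq> - 1" and m: "1 \<le> m" and \<epsilon>: "\<epsilon> * \<epsilon> = 1"
  shows "irreducible_representation (braid_group (2 * m)) fun_scale (complement_eigenspace m \<epsilon>)
    (subrepresentation (braid_rep (2 * m) m t) (complement_eigenspace m \<epsilon>))"
proof -
  let ?W = "complement_eigenspace m \<epsilon>" and ?\<phi> = "braid_rep (2 * m) m t"
  have WV: "?W \<subseteq> braid_space (2 * m) m" by (auto simp: complement_eigenspace_def)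
  have "\<exists>B. finite B \<and> fun_space.span B = ?W"
    by (intro exI[of _ "eigenvector_pair m \<epsilon> ` tuples (2 * m) m"])
       (simp add: span_eigenvector_pairs[OF \<epsilon>] finite_tuples)
  then have "representation (braid_group (2 * m)) fun_scale ?W (subrepresentation ?\<phi> ?W)"
    by (rule representation_subrepresentation[OF representation_braid_rep[OF t(1)]
          complement_eigenspace_invariant[OF t(1)]])
  moreover have "U = {0} \<or> U = ?W"
    if U: "invariant_subspace (braid_group (2 * m)) fun_scale ?W (subrepresentation ?\<phi> ?W) U" for U
  proof -
    interpret braid_closed_subspace "2 * m" m t U
      by (rule invariant_subspace_braid_closed[OF t invariant_subspace_subrepresentation[OF U WV]])
    show ?thesis
      using eq_complement_eigenspace[OF HOL.refl m \<epsilon>] U by (auto simp: invariant_subspace_def)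
  qed
  ultimately show ?thesis
    using complement_eigenspace_nontrivial[OF m \<epsilon>] by (simp add: irreducible_representation_def)
qed

theorem theorem2p3:
  fixes n m :: nat and t :: real
  assumes "n > 2" and "t \<noteq> 0" "t \<noteq> 1" "t \<noteq> - 1" and "1 \<le> m" "m < n"
  shows "(2 * m \<noteq> n \<longrightarrow>
      irreducible_representation (braid_group n) fun_scale (braid_space n m) (braid_rep n m t)) \<and>
    (n = 2 * m \<longrightarrow>
      sum_of_two_irreducibles (braid_group n) fun_scale (braid_space n m) (braid_rep n m t))"
proof (intro conjI impI)
  note t = assms(2-4)
  assume nm: "2 * m \<noteq> n"
  obtain x where x: "x \<in> tuples n m" using tuples_nonempty[of m n] assms by auto
  have "basis_vector x \<noteq> 0" by (auto simp: basis_vector_def fun_eq_iff)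
  then have "braid_space n m \<noteq> {0}" using basis_vector_in_space[OF x] by blast
  moreover have "W = {0} \<or> W = braid_space n m"
    if "invariant_subspace (braid_group n) fun_scale (braid_space n m) (braid_rep n m t) W" for W
    using braid_closed_subspace.eq_braid_space[OF invariant_subspace_braid_closed[OF t that]]
      nm assms(1) by auto
  ultimately show
    "irreducible_representation (braid_group n) fun_scale (braid_space n m) (braid_rep n m t)"
    using representation_braid_rep[OF t(1)] by (simp add: irreducible_representation_def)
next
  note t = assms(2-4)
  assume n: "n = 2 * m"
  show "sum_of_two_irreducibles (braid_group n) fun_scale (braid_space n m) (braid_rep n m t)"
    unfolding sum_of_two_irreducibles_def n
    by (intro conjI exI[of _ "complement_eigenspace m 1"] exI[of _ "complement_eigenspace m (- 1)"]
        representation_braid_rep complement_eigenspace_invariant braid_space_decomposition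
        complement_eigenspaces_Int irreducible_complement_eigenspace t assms) simp_all
qed

end
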